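(* Every complete separable ultrahomogeneous metric space $Y$ includes a countable ultrahomogeneous dense metric subspace, i.e. there is a countable dense subset $X\subset Y$ which, equipped with the induced metric, is an ultrahomogeneous metric space.
   Context: A metric space $X$ is ultrahomogeneous when every isometry between two finite metric subspaces of $X$ can be extended to an isometry of $X$ onto itself. Countable means finite or countably infinite. *)

theory Defs
  imports "HOL-Analysis.Analysis"
begin

definition isometry :: "'a metric \<Rightarrow> 'b metric \<Rightarrow> ('a \<Rightarrow> 'b) \<Rightarrow> bool" where
  "isometry M N f \<longleftrightarrow>
     bij_betw f (mspace M) (mspace N) \<and>
     (\<forall>x\<in>mspace M. \<forall>y\<in>mspace M. mdist N (f x) (f y) = mdist M x y)"

definition ultrahomogeneous :: "'a metric \<Rightarrow> bool" where
  "ultrahomogeneous M \<longleftrightarrow>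
     (\<forall>A B f. A \<subseteq> mspace M \<and> B \<subseteq> mspace M \<and> finite A \<and> finite B \<and>
        isometry (submetric M A) (submetric M B) f \<longrightarrow>
        (\<exists>g. isometry M M g \<and> (\<forall>x\<in>A. g x = f x)))"

end

theory Submission
  imports Defs
begin

text \<open>
  The idea is a closing-off argument of Loewenheim-Skolem type. Every finite partial isometry
  between points of the space has, by ultrahomogeneity, a total extension; one such extension is
  chosen for each graph once and for all. A countable set has only countably many finite subsets,
  so a countable dense set can be enlarged to a countable set \<open>X\<close> that is closed under every chosen
  extension whose graph lies in \<open>X \<times> X\<close>, and under the inverses of these extensions
  (lemma \<open>countable_closure_finite_dependence\<close>). Closure under the inverses makes the restriction
  of such an extension to \<open>X\<close> surjective, hence an isometry of \<open>X\<close> onto itself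
  (lemma \<open>isometry_submetric_invariant\<close>). Density is inherited by supersets.
\<close>

text \<open>
  Here \<open>\<Phi> F\<close> collects the points that a finite set \<open>F\<close> forces into the closure. Adding them
  \<open>\<omega>\<close> times suffices, because a finite subset of the union already lies in one stage.
\<close>
lemma countable_closure_finite_dependence:
  fixes \<Phi> :: "'a set \<Rightarrow> 'a set"
  assumes "countable D" and "D \<subseteq> S"
    and \<Phi>: "\<And>F. finite F \<Longrightarrow> F \<subseteq> S \<Longrightarrow> countable (\<Phi> F) \<and> \<Phi> F \<subseteq> S"
  obtains X where "D \<subseteq> X" "X \<subseteq> S" "countable X"
    "\<And>F. finite F \<Longrightarrow> F \<subseteq> X \<Longrightarrow> \<Phi> F \<subseteq> X"
proof -
  define step where "step U = U \<union> (\<Union>F\<in>{F. finite F \<and> F \<subseteq> U}. \<Phi> F)" for U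
  define V where "V n = (step ^^ n) D" for n
  have V_Suc: "V (Suc n) = step (V n)" for n
    by (simp add: V_def)
  have V: "countable (V n) \<and> V n \<subseteq> S" for n
  proof (induction n)
    case 0
    then show ?case using assms by (simp add: V_def)
  next
    case (Suc n)
    then have "countable (\<Phi> F)" "\<Phi> F \<subseteq> S" if "F \<subseteq> V n" "finite F" for F
      using \<Phi> that by blast+
    then show ?case
      unfolding V_Suc step_def
      using Suc by (auto intro!: countable_Collect_finite_subset)
  qed
  have "incseq V"
    by (rule incseq_SucI) (simp add: V_Suc step_def)
  show thesis
  proof
    show "D \<subseteq> (\<Union>n. V n)"
      using UN_upper[of 0 UNIV V] by (simp add: V_def)
    show "(\<Union>n. V n) \<subseteq> S" "countable (\<Union>n. V n)"
      using V by auto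
    fix F assume "finite F" "F \<subseteq> (\<Union>n. V n)"
    then have "\<exists>n. F \<subseteq> V n"
    proof (induction F)
      case empty
      then show ?case by blast
    next
      case (insert x F)
      from insert.prems obtain m where "x \<in> V m"
        by blast
      moreover from insert obtain n where "F \<subseteq> V n"
        by auto
      ultimately have "insert x F \<subseteq> V (max m n)"
        using incseqD[OF \<open>incseq V\<close>, of m "max m n"] incseqD[OF \<open>incseq V\<close>, of n "max m n"]
        by auto
      then show ?case ..
    qed
    then obtain n where "F \<subseteq> V n" ..
    with \<open>finite F\<close> have "\<Phi> F \<subseteq> V (Suc n)"
      by (auto simp: V_Suc step_def)
    then show "\<Phi> F \<subseteq> (\<Union>n. V n)"
      by blast
  qed
qed

text \<open>
  Invariance under \<open>g\<close> alone would not do: a shift maps a half-line of integers properly into itself.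
\<close>
lemma isometry_submetric_invariant:
  assumes g: "isometry M M g" and "X \<subseteq> mspace M"
    and fwd: "g ` X \<subseteq> X" and bwd: "inv_into (mspace M) g ` X \<subseteq> X"
  shows "isometry (submetric M X) (submetric M X) g"
proof -
  have bij: "bij_betw g (mspace M) (mspace M)"
    using g by (simp add: isometry_def)
  have "X \<subseteq> g ` X"
  proof
    fix x assume "x \<in> X"
    then have "g (inv_into (mspace M) g x) = x"
      using bij \<open>X \<subseteq> mspace M\<close> by (auto simp: bij_betw_def f_inv_into_f)
    with \<open>x \<in> X\<close> bwd show "x \<in> g ` X"
      by (metis imageI subsetD)
  qed
  then have "bij_betw g X X"
    using bij fwd \<open>X \<subseteq> mspace M\<close> by (auto simp: bij_betw_def intro: inj_on_subset)
  then show ?thesis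
    using g \<open>X \<subseteq> mspace M\<close> by (auto simp: isometry_def Int_absorb2)
qed

theorem theorem6:
  fixes Y :: "'a metric"
  assumes "mcomplete_of Y"
    and "separable_space (mtopology_of Y)"
    and "ultrahomogeneous Y"
  shows "\<exists>X. X \<subseteq> mspace Y \<and> countable X \<and>
           mtopology_of Y closure_of X = mspace Y \<and>
           ultrahomogeneous (submetric Y X)"
proof -
  define S where "S = mspace Y"
  obtain D where D: "countable D" "D \<subseteq> S" "mtopology_of Y closure_of D = S"
    using assms(2) by (auto simp: separable_space_def S_def)
  define extends where "extends p g \<longleftrightarrow> isometry Y Y g \<and> (\<forall>(x, y)\<in>p. g x = y)"
    for p :: "('a \<times> 'a) set" and g
  define E where "E p = (SOME g. extends p g)" for p
  have E: "extends p (E p)" if "extends p g" for p g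
    using that unfolding E_def by (rule someI[of "extends p"])
  \<comment> \<open>For a graph without an extension \<open>E p\<close> is an arbitrary function; intersecting with \<open>S\<close> discards
    the values that leave the space.\<close>
  define \<Phi> where "\<Phi> F = S \<inter> (\<Union>p\<in>Pow (F \<times> F). E p ` F \<union> inv_into S (E p) ` F)" for F
  have "countable (\<Phi> F) \<and> \<Phi> F \<subseteq> S" if "finite F" "F \<subseteq> S" for F
    using that finite_subset[OF _ that(1)]
    by (auto simp: \<Phi>_def intro!: countable_finite)
  then obtain X where X: "D \<subseteq> X" "X \<subseteq> S" "countable X"
    and closed: "\<And>F. finite F \<Longrightarrow> F \<subseteq> X \<Longrightarrow> \<Phi> F \<subseteq> X"
    using countable_closure_finite_dependence[OF D(1,2), of \<Phi>] by metis
  have "mtopology_of Y closure_of X = mspace Y"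
    using closure_of_mono[OF X(1), of "mtopology_of Y"] D(3)
      closure_of_subset_topspace[of "mtopology_of Y" X] by (auto simp: S_def)
  moreover have "ultrahomogeneous (submetric Y X)"
    unfolding ultrahomogeneous_def
  proof (intro allI impI, elim conjE)
    fix A B f
    assume AB: "A \<subseteq> mspace (submetric Y X)" "B \<subseteq> mspace (submetric Y X)" "finite A" "finite B"
      and f: "isometry (submetric (submetric Y X) A) (submetric (submetric Y X) B) f"
    have sub: "A \<subseteq> X" "B \<subseteq> X" "A \<subseteq> S" "B \<subseteq> S"
      using AB X by auto
    have f': "isometry (submetric Y A) (submetric Y B) f"
      using f sub X by (simp add: Int_absorb1)
    define p where "p = (\<lambda>x. (x, f x)) ` A"
    obtain g0 where "isometry Y Y g0" "\<forall>x\<in>A. g0 x = f x"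
      using assms(3)[unfolded ultrahomogeneous_def, rule_format, of A B f] f' AB(3,4) sub
      by (auto simp: S_def)
    then have "extends p g0"
      by (auto simp: extends_def p_def)
    then have "extends p (E p)"
      by (rule E)
    then have iso: "isometry Y Y (E p)" and ext: "\<forall>x\<in>A. E p x = f x"
      by (auto simp: extends_def p_def)
    have bij: "bij_betw (E p) S S"
      using iso by (simp add: isometry_def S_def)
    have "f ` A = B"
      using f' sub by (auto simp: isometry_def bij_betw_def S_def Int_absorb2)
    then have p: "p \<subseteq> (A \<union> B) \<times> (A \<union> B)"
      by (auto simp: p_def)
    have "E p x \<in> X \<and> inv_into S (E p) x \<in> X" if "x \<in> X" for x
    proof -
      \<comment> \<open>The finite set must contain the argument \<open>x\<close> as well as the points of the graph.\<close>
      define F where "F = insert x (A \<union> B)"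
      have "x \<in> F" "p \<in> Pow (F \<times> F)"
        using p by (auto simp: F_def)
      moreover have "E p x \<in> S" "inv_into S (E p) x \<in> S"
        using bij bij_betw_inv_into[OF bij] that X(2) by (auto dest: bij_betwE)
      ultimately have "E p x \<in> \<Phi> F" "inv_into S (E p) x \<in> \<Phi> F"
        unfolding \<Phi>_def by blast+
      moreover have "\<Phi> F \<subseteq> X"
        using AB(3,4) sub that by (intro closed) (auto simp: F_def)
      ultimately show ?thesis by blast
    qed
    then have "isometry (submetric Y X) (submetric Y X) (E p)"
      using iso X(2) by (intro isometry_submetric_invariant) (auto simp: S_def)
    with ext show "\<exists>g. isometry (submetric Y X) (submetric Y X) g \<and> (\<forall>x\<in>A. g x = f x)"
      by blast
  qed
  ultimately show ?thesis
    using X by (auto simp: S_def)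
qed

end
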